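(* Let $K\ge 2$, and consider an ordered Combinatorial DDGP instance in $\mathbb{R}^K$ with nondegenerate parameters. Assume that the full solution code $\Xi$ is nonempty and that the parameters of the instance are mirror-separated. Then for every reference solution $s^\ast\in\Xi$, with constrained restriction $s^\ast_{\mathrm c}=s^\ast|_{B_{\mathrm c}}$, $$\Xi_F \;=\; s^\ast_{\mathrm c}\oplus \mathcal{K}_F \;=\; s^\ast_{\mathrm c}\oplus M(\ker V).$$ Consequently, $$|\Xi| \;=\; 2^{\,f+\operatorname{rank}_{\mathbb{F}_2}\begin{bmatrix} M\\ V\end{bmatrix}-\operatorname{rank}_{\mathbb{F}_2}(V)} .$$
   Context: Ordered instance. Let $K\ge 1$, $n\ge K$. The vertex set is $[n]=\{1,\dots,n\}$, $G=([n],E)$ is a simple undirected graph with edge lengths $d:E\to\mathbb{R}_+$. The seed set $V_0=\{1,\dots,K\}$ is a clique of $G$. For $i\le K$ put $U_i=\varnothing$; for every $i>K$ a predecessor set $U_i\subseteq\{1,\dots,i-1\}$ with $|U_i|=K$ is fixed, $U_i$ induces a clique in $G$, and $\{u,i\}\in E$ for all $u\in U_i$. Closures. $\operatorname{Fix}(i)=\{i\}\cup\bigcup_{u\in U_i}\operatorname{Fix}(u)$ and $\operatorname{Cone}(i)=\{i\}\cup\bigcup_{w:\, i\in U_w}\operatorname{Cone}(w)$. Edges and branch sets. $E_D=\binom{V_0}{2}\cup\{\{u,i\}: i>K,\ u\in U_i\}$ (seed and discretization edges), $E_P=E\setminus E_D$ (pruning edges), $B=[n]\setminus V_0$, $L=\bigcup_{\{u,v\}\in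 E_P}(\operatorname{Fix}(u)\cup\operatorname{Fix}(v))$, $B_{\mathrm c}=L\setminus V_0$, $B_{\mathrm f}=B\setminus B_{\mathrm c}$, $f=|B_{\mathrm f}|$. The active edge set is $F=E_D[L]\cup E_P$, where $E_D[L]$ is the set of edges of $E_D$ with both endpoints in $L$. Branch codes and embeddings. The seed vertices are placed at fixed points of $\mathbb{R}^K$ realizing the lengths $d$ on $\binom{V_0}{2}$. A full branch code is $s\in\mathbb{F}_2^B$. The embedding $x(s)=(x_a(s))_{a\in[n]}$ is obtained by placing vertices $i=K+1,\dots,n$ successively: $x_i(s)$ is one of the two points of the intersection of the $K$ spheres centered at $x_u(s)$ with radius $d_{ui}$ ($u\in U_i$). These two points are mirror images across the affine hyperplane spanned by $\{x_u(s):u\in U_i\}$, and the bit $s_i$ selects one by local orientation: writing $U_i=\{u_1<\dots<u_K\}$, $s_i$ records the sign of $\det(x_{u_2}-x_{u_1},\dots,x_{u_K}-x_{u_1},x_i-x_{u_1})$ (say $s_i=0$ for positive, $s_i=1$ for negative). The parameters (seed positions and edge lengths) are nondegenerate if every lateration step is well defined and, for every branch code, each such intersection of $K$ spheres consists of exactly two distinct points. Solution codes. $\Xi=\{s\in\mathbb{F}_2^B: \|x_a(s)-x_b(s)\|_2=d_{ab}\ \forall\{a,b\}\in E\}$. $\Xi_F=\{s_{\mathrm c}\in\mathbb{F}_2^{B_{\mathrm c}}:\|x_a(s)-x_b(s)\|_2=d_{ab}\ \forall\{a,b\}\in F\}$, where $s$ is any full branch code with $s|_{B_{\mathrm c}}=s_{\mathrm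 c}$ (the condition does not depend on the choice of $s$). Generators. A generator is a pair $g=(m_g,C_g)$, with mask $m_g\in\mathbb{F}_2^{B_{\mathrm c}}$ and mirror clique $C_g$; write $S_g=\operatorname{supp}(m_g)\subseteq B_{\mathrm c}$. For $q\in B_{\mathrm c}$ the cone generator $g_q$ has $S_{g_q}=B_{\mathrm c}\cap\operatorname{Cone}(q)$ and $C_{g_q}=U_q$. Let $\mathcal{C}=\{U_w: w\in B_{\mathrm c}\}$. For $C\in\mathcal{C}$ the base generator $g_C$ has $S_{g_C}=\bigcup_{w\in B_{\mathrm c},\,U_w=C}(B_{\mathrm c}\cap\operatorname{Cone}(w))$ and mirror clique $C$. $\mathcal{G}$ is the labeled (indexed) family $\{g_q:q\in B_{\mathrm c}\}\sqcup\{g_C:C\in\mathcal{C}\}$, duplicates being kept as distinct members; $A=\mathbb{F}_2^{\mathcal{G}}$. Matrices. The mask matrix $M:A\to\mathbb{F}_2^{B_{\mathrm c}}$ is the linear map $M\alpha=\bigoplus_{g:\alpha_g=1}m_g$. A generator $g$ violates an edge $e\in F$ if $|e\cap S_g|=1$ and $e\setminus S_g\not\subseteq C_g$. Let $\mathcal{L}=\{(e,C_g): g\in\mathcal{G},\ e\in F,\ g\text{ violates }e\}$. The labeled violation matrix $V:A\to\mathbb{F}_2^{\mathcal{L}}$ is the linear map whose entry in row $(e,C)$ and column $g$ is $1$ if $C=C_g$ and $g$ violates $e$, and $0$ otherwise. $\begin{bmatrix} M\\ V\end{bmatrix}$ is the vertically stacked matrix. Put $\mathcal{K}_F=M(\ker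 V)\subseteq\mathbb{F}_2^{B_{\mathrm c}}$. Mirror separation. Nondegenerate parameters are mirror-separated if for every $h\in\mathbb{F}_2^{B_{\mathrm c}}\setminus\mathcal{K}_F$ (extended by zero on $B_{\mathrm f}$) and every $s\in\mathbb{F}_2^B$ there is an edge $\{a,b\}\in F$ with $\|x_a(s\oplus h)-x_b(s\oplus h)\|_2^2\ne\|x_a(s)-x_b(s)\|_2^2$. *)

theory Defs
  imports
    "HOL-Analysis.Analysis"
    "HOL-Library.Z2"
    "HOL-Library.Function_Algebras"
begin

section \<open>Vectors over the two-element field\<close>

text \<open>
  The space of vectors over GF(2) indexed by a set \<open>X\<close> consists of the functions into the field
  \<^typ>\<open>bit\<close> that vanish off \<open>X\<close>. Pointwise addition is then the exclusive or, and vectors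
  indexed by a subset of \<open>X\<close> are included by zero-extension.
\<close>

definition gf2_vecs :: "'a set \<Rightarrow> ('a \<Rightarrow> bit) set" where
  "gf2_vecs X = {v. \<forall>a. a \<notin> X \<longrightarrow> v a = 0}"

definition supp :: "('a \<Rightarrow> bit) \<Rightarrow> 'a set" where
  "supp v = {a. v a = 1}"

definition indic :: "'a set \<Rightarrow> 'a \<Rightarrow> bit" where
  "indic X a = (if a \<in> X then 1 else 0)"

definition restr :: "('a \<Rightarrow> bit) \<Rightarrow> 'a set \<Rightarrow> 'a \<Rightarrow> bit" where
  "restr v X a = (if a \<in> X then v a else 0)"

definition gf2_scale :: "bit \<Rightarrow> ('a \<Rightarrow> bit) \<Rightarrow> 'a \<Rightarrow> bit" where
  "gf2_scale c v = (\<lambda>a. c * v a)"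

interpretation gf2: vector_space gf2_scale
  by unfold_locales (auto simp: gf2_scale_def fun_eq_iff algebra_simps)

definition gf2_kernel :: "('a \<Rightarrow> bit) set \<Rightarrow> (('a \<Rightarrow> bit) \<Rightarrow> 'b \<Rightarrow> bit) \<Rightarrow> ('a \<Rightarrow> bit) set" where
  "gf2_kernel A T = {\<alpha> \<in> A. T \<alpha> = 0}"

definition gf2_rank :: "('a \<Rightarrow> bit) set \<Rightarrow> (('a \<Rightarrow> bit) \<Rightarrow> 'b \<Rightarrow> bit) \<Rightarrow> nat" where
  "gf2_rank A T = gf2.dim (T ` A)"


section \<open>Instances\<close>

text \<open>
  The ambient dimension \<open>K\<close> is \<open>CARD('k)\<close>. Edges are two-element sets of vertices and
  \<open>len\<close> is indexed by edges; \<open>seed\<close> gives the fixed points at which the seed vertices are placed.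
\<close>

record ('k :: finite) ddgp =
  nverts :: nat
  edges :: "nat set set"
  len :: "nat set \<Rightarrow> real"
  preds :: "nat \<Rightarrow> nat set"
  seed :: "nat \<Rightarrow> real ^ 'k"

definition verts :: "('k :: finite) ddgp \<Rightarrow> nat set" where
  "verts I = {1..nverts I}"

definition seed_verts :: "('k :: finite) ddgp \<Rightarrow> nat set" where
  "seed_verts I = {1..CARD('k)}"

definition clique :: "nat set set \<Rightarrow> nat set \<Rightarrow> bool" where
  "clique E X \<longleftrightarrow> (\<forall>a\<in>X. \<forall>b\<in>X. a \<noteq> b \<longrightarrow> {a, b} \<in> E)"

definition ordered_instance :: "('k :: finite) ddgp \<Rightarrow> bool" where
  "ordered_instance I \<longleftrightarrow>
     CARD('k) \<le> nverts I \<and>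
     edges I \<subseteq> {{a, b} | a b. a \<in> verts I \<and> b \<in> verts I \<and> a \<noteq> b} \<and>
     (\<forall>e\<in>edges I. 0 \<le> len I e) \<and>
     clique (edges I) (seed_verts I) \<and>
     (\<forall>i\<in>seed_verts I. preds I i = {}) \<and>
     (\<forall>i\<in>verts I - seed_verts I.
        preds I i \<subseteq> {1..i - 1} \<and> card (preds I i) = CARD('k) \<and>
        clique (edges I) (preds I i) \<and> (\<forall>u\<in>preds I i. {u, i} \<in> edges I)) \<and>
     (\<forall>a\<in>seed_verts I. \<forall>b\<in>seed_verts I. a \<noteq> b \<longrightarrow>
        norm (seed I a - seed I b) = len I {a, b})"

text \<open>The closures are defined by recursion along the predecessor relation, as least solutions
  of their recursion equations (proved below).\<close>

inductive in_Fix :: "('k :: finite) ddgp \<Rightarrow> nat \<Rightarrow> nat \<Rightarrow> bool" for I where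
  self: "in_Fix I i i"
| step: "u \<in> preds I i \<Longrightarrow> in_Fix I u j \<Longrightarrow> in_Fix I i j"

inductive in_Cone :: "('k :: finite) ddgp \<Rightarrow> nat \<Rightarrow> nat \<Rightarrow> bool" for I where
  self: "in_Cone I i i"
| step: "w \<in> verts I \<Longrightarrow> i \<in> preds I w \<Longrightarrow> in_Cone I w j \<Longrightarrow> in_Cone I i j"

definition Fix :: "('k :: finite) ddgp \<Rightarrow> nat \<Rightarrow> nat set" where
  "Fix I i = {j. in_Fix I i j}"

definition Cone :: "('k :: finite) ddgp \<Rightarrow> nat \<Rightarrow> nat set" where
  "Cone I i = {j. in_Cone I i j}"

lemma Fix_rec: "Fix I i = {i} \<union> (\<Union>u\<in>preds I i. Fix I u)"
  unfolding Fix_def by (auto intro: in_Fix.intros elim: in_Fix.cases)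

lemma Cone_rec: "Cone I i = {i} \<union> (\<Union>w\<in>{w \<in> verts I. i \<in> preds I w}. Cone I w)"
  unfolding Cone_def by (auto intro: in_Cone.intros elim: in_Cone.cases)

definition branch_verts :: "('k :: finite) ddgp \<Rightarrow> nat set" where
  "branch_verts I = verts I - seed_verts I"

definition disc_edges :: "('k :: finite) ddgp \<Rightarrow> nat set set" where
  "disc_edges I = {{a, b} | a b. a \<in> seed_verts I \<and> b \<in> seed_verts I \<and> a \<noteq> b}
     \<union> {{u, i} | u i. i \<in> branch_verts I \<and> u \<in> preds I i}"

definition prune_edges :: "('k :: finite) ddgp \<Rightarrow> nat set set" where
  "prune_edges I = edges I - disc_edges I"

definition active_verts :: "('k :: finite) ddgp \<Rightarrow> nat set" where
  "active_verts I = (\<Union>e\<in>prune_edges I. \<Union>u\<in>e. Fix I u)"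

definition constrained :: "('k :: finite) ddgp \<Rightarrow> nat set" where
  "constrained I = active_verts I - seed_verts I"

definition free_verts :: "('k :: finite) ddgp \<Rightarrow> nat set" where
  "free_verts I = branch_verts I - constrained I"

definition active_edges :: "('k :: finite) ddgp \<Rightarrow> nat set set" where
  "active_edges I = {e \<in> disc_edges I. e \<subseteq> active_verts I} \<union> prune_edges I"


section \<open>Embeddings and solution codes\<close>

definition lateration :: "('k :: finite) ddgp \<Rightarrow> (nat \<Rightarrow> real ^ 'k) \<Rightarrow> nat \<Rightarrow> (real ^ 'k) set" where
  "lateration I x i = (\<Inter>u\<in>preds I i. sphere (x u) (len I {u, i}))"

text \<open>
  The matrix below has the columns
  \<open>x u\<^sub>2 - x u\<^sub>1, \<dots>, x u\<^sub>K - x u\<^sub>1, x i - x u\<^sub>1\<close>, where \<open>u\<^sub>1 < \<dots> < u\<^sub>K\<close> are the predecessors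
  of \<open>i\<close>. The linear order on the coordinate type \<open>'k\<close> turns the column index \<open>c\<close> into its
  position \<open>card {c'. c' < c}\<close>, counted from 0.
\<close>

definition orientation ::
    "'k ddgp \<Rightarrow> (nat \<Rightarrow> real ^ ('k :: {finite, linorder})) \<Rightarrow> nat \<Rightarrow> real" where
  "orientation I x i =
     (let us = sorted_list_of_set (preds I i);
          cols = map (\<lambda>v. x v - x (hd us)) (tl us @ [i])
      in det (\<chi> r c. (cols ! card {c'. c' < c}) $ r))"

definition place ::
    "'k ddgp \<Rightarrow> (nat \<Rightarrow> bit) \<Rightarrow> nat \<Rightarrow> (nat \<Rightarrow> real ^ ('k :: {finite, linorder})) \<Rightarrow>
      nat \<Rightarrow> real ^ ('k :: {finite, linorder})" where
  "place I s i x = x(i := (THE y. y \<in> lateration I x i \<and>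
     (if s i = 0 then orientation I (x(i := y)) i > 0 else orientation I (x(i := y)) i < 0)))"

definition embed ::
    "'k ddgp \<Rightarrow> (nat \<Rightarrow> bit) \<Rightarrow> nat \<Rightarrow> real ^ ('k :: {finite, linorder})" where
  "embed I s = fold (place I s) [CARD('k) + 1..<nverts I + 1] (seed I)"

text \<open>A lateration step is well defined if the centres are affinely independent, so that they
  span a hyperplane.\<close>

definition nondegenerate :: "('k :: {finite, linorder}) ddgp \<Rightarrow> bool" where
  "nondegenerate I \<longleftrightarrow>
     (\<forall>s\<in>gf2_vecs (branch_verts I). \<forall>i\<in>branch_verts I.
        inj_on (embed I s) (preds I i) \<and> \<not> affine_dependent (embed I s ` preds I i) \<and>
        card (lateration I (embed I s) i) = 2)"

definition realizes :: "('k :: finite) ddgp \<Rightarrow> nat set set \<Rightarrow> (nat \<Rightarrow> real ^ 'k) \<Rightarrow> bool" where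
  "realizes I E' x \<longleftrightarrow> (\<forall>a b. {a, b} \<in> E' \<longrightarrow> norm (x a - x b) = len I {a, b})"

definition solutions :: "('k :: {finite, linorder}) ddgp \<Rightarrow> (nat \<Rightarrow> bit) set" where
  "solutions I = {s \<in> gf2_vecs (branch_verts I). realizes I (edges I) (embed I s)}"

definition constrained_solutions :: "('k :: {finite, linorder}) ddgp \<Rightarrow> (nat \<Rightarrow> bit) set" where
  "constrained_solutions I = {t \<in> gf2_vecs (constrained I).
     \<forall>s\<in>gf2_vecs (branch_verts I). restr s (constrained I) = t \<longrightarrow>
       realizes I (active_edges I) (embed I s)}"


section \<open>Generators and their matrices\<close>

text \<open>The generators form a family indexed by labels, so that equal pairs of mask and mirror
  clique with different labels stay distinct columns.\<close>

datatype gen_label = Cone_gen nat | Base_gen "nat set"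

fun generator :: "('k :: finite) ddgp \<Rightarrow> gen_label \<Rightarrow> (nat \<Rightarrow> bit) \<times> nat set" where
  "generator I (Cone_gen q) = (indic (constrained I \<inter> Cone I q), preds I q)"
| "generator I (Base_gen C) =
     (indic (\<Union>w\<in>{w \<in> constrained I. preds I w = C}. constrained I \<inter> Cone I w), C)"

definition mask :: "('k :: finite) ddgp \<Rightarrow> gen_label \<Rightarrow> nat \<Rightarrow> bit" where
  "mask I g = fst (generator I g)"

definition mirror :: "('k :: finite) ddgp \<Rightarrow> gen_label \<Rightarrow> nat set" where
  "mirror I g = snd (generator I g)"

definition gens :: "('k :: finite) ddgp \<Rightarrow> gen_label set" where
  "gens I = Cone_gen ` constrained I \<union> Base_gen ` (preds I ` constrained I)"

definition gen_space :: "('k :: finite) ddgp \<Rightarrow> (gen_label \<Rightarrow> bit) set" where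
  "gen_space I = gf2_vecs (gens I)"

definition mask_map :: "('k :: finite) ddgp \<Rightarrow> (gen_label \<Rightarrow> bit) \<Rightarrow> nat \<Rightarrow> bit" where
  "mask_map I \<alpha> = (\<Sum>g\<in>{g \<in> gens I. \<alpha> g = 1}. mask I g)"

definition violates :: "('k :: finite) ddgp \<Rightarrow> gen_label \<Rightarrow> nat set \<Rightarrow> bool" where
  "violates I g e \<longleftrightarrow>
     card (e \<inter> supp (mask I g)) = 1 \<and> \<not> e - supp (mask I g) \<subseteq> mirror I g"

definition viol_rows :: "('k :: finite) ddgp \<Rightarrow> (nat set \<times> nat set) set" where
  "viol_rows I = {(e, mirror I g) | e g. g \<in> gens I \<and> e \<in> active_edges I \<and> violates I g e}"

definition viol_entry :: "('k :: finite) ddgp \<Rightarrow> nat set \<times> nat set \<Rightarrow> gen_label \<Rightarrow> bit" where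
  "viol_entry I r g = (case r of (e, C) \<Rightarrow> if C = mirror I g \<and> violates I g e then 1 else 0)"

definition viol_map ::
    "('k :: finite) ddgp \<Rightarrow> (gen_label \<Rightarrow> bit) \<Rightarrow> nat set \<times> nat set \<Rightarrow> bit" where
  "viol_map I \<alpha> r = (if r \<in> viol_rows I then \<Sum>g\<in>gens I. viol_entry I r g * \<alpha> g else 0)"

definition stacked_map ::
    "('k :: finite) ddgp \<Rightarrow> (gen_label \<Rightarrow> bit) \<Rightarrow> nat + nat set \<times> nat set \<Rightarrow> bit" where
  "stacked_map I \<alpha> = case_sum (mask_map I \<alpha>) (viol_map I \<alpha>)"

definition mirror_space :: "('k :: finite) ddgp \<Rightarrow> (nat \<Rightarrow> bit) set" where
  "mirror_space I = mask_map I ` gf2_kernel (gen_space I) (viol_map I)"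

definition mirror_separated :: "('k :: {finite, linorder}) ddgp \<Rightarrow> bool" where
  "mirror_separated I \<longleftrightarrow>
     (\<forall>h\<in>gf2_vecs (constrained I) - mirror_space I. \<forall>s\<in>gf2_vecs (branch_verts I).
        \<exists>a b. {a, b} \<in> active_edges I \<and>
          (norm (embed I (s + h) a - embed I (s + h) b))\<^sup>2 \<noteq> (norm (embed I s a - embed I s b))\<^sup>2)"

end

theory Submission
  imports Defs
begin

text \<open>
  Group the generators selected by \<open>\<alpha>\<close> by their mirror clique \<open>C\<close> and add up the masks of each group.
  The violation matrix kills \<open>\<alpha>\<close> if and only if each summed mask is constant on all active edges
  missing \<open>C\<close>, even if single generators violate edges. Flipping the bits of such a summed mask
  therefore acts on the active vertices as a partial reflection across the hyperplane spanned by
  \<open>C\<close>: orientations change sign exactly on the flipped vertices, and an active edge leaving the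
  flipped set has its other end on the mirror. So all active lengths are preserved for every
  branch code. Mirror separation gives the converse, so the constrained solutions form a coset of
  \<open>M (ker V)\<close>. The free bits are arbitrary, and the count follows from
  \<open>card A = card (ker T) * card (T A)\<close> for \<open>V\<close>, for the stacked map, and for \<open>M\<close> on \<open>ker V\<close>.
\<close>

section \<open>Counting in vector spaces over the two-element field\<close>

lemma bit_add_self: "(b::bit) + b = 0"
  by (cases b) simp_all

lemma gf2_add_self: "(v::'a \<Rightarrow> bit) + v = 0"
  by (simp add: fun_eq_iff bit_add_self)

lemma gf2_add_cancel: "(v::'a \<Rightarrow> bit) + (v + w) = w"
  by (simp add: gf2_add_self flip: add.assoc)

lemma gf2_additive_0:
  fixes T :: "('a \<Rightarrow> bit) \<Rightarrow> 'b \<Rightarrow> bit"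
  assumes "T (0 + 0) = T 0 + T 0"
  shows "T 0 = 0"
  using assms by (simp add: gf2_add_self)

lemma gf2_subspaceI:
  \<comment> \<open>The only scalars are 0 and 1, so closure under addition already gives closure
    under scaling.\<close>
  assumes "0 \<in> S" "\<And>v w. v \<in> S \<Longrightarrow> w \<in> S \<Longrightarrow> v + w \<in> S"
  shows "gf2.subspace S"
proof (rule gf2.subspaceI)
  fix c :: bit and v assume "v \<in> S"
  then show "gf2_scale c v \<in> S"
    using assms(1) by (cases c) (simp_all only: gf2.scale_zero_left gf2.scale_one)
qed (use assms in auto)

text \<open>With scalars 0 and 1 only, adjoining an independent vector \<open>b\<close> turns the
  span into the disjoint union of the old span and its translate by \<open>b\<close>, so the size
  doubles.\<close>

lemma gf2_card_span:
  assumes "finite B" "gf2.independent B"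
  shows "finite (gf2.span B) \<and> card (gf2.span B) = 2 ^ card B"
  using assms
proof (induction B rule: finite_induct)
  case empty
  then show ?case by simp
next
  case (insert b B)
  have b: "b \<notin> gf2.span B" and ind: "gf2.independent B"
    using insert.prems insert.hyps by (auto simp: gf2.independent_insert)
  note IH = insert.IH[OF ind]
  have "gf2.span (insert b B) = gf2.span B \<union> (\<lambda>x. b + x) ` gf2.span B"
  proof -
    have "x \<in> gf2.span (insert b B) \<longleftrightarrow> x \<in> gf2.span B \<or> x - b \<in> gf2.span B" for x
    proof -
      have "(\<exists>k. P k) \<longleftrightarrow> P 0 \<or> P 1" for P :: "bit \<Rightarrow> bool"
        by (metis (full_types) bit_not_one_iff)
      then show ?thesis
        unfolding gf2.span_insert by (simp only: mem_Collect_eq gf2.scale_zero_left gf2.scale_one diff_zero)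
    qed
    then show ?thesis by (force simp: image_iff algebra_simps)
  qed
  moreover have "gf2.span B \<inter> (\<lambda>x. b + x) ` gf2.span B = {}"
  proof -
    have "b + x \<notin> gf2.span B" if "x \<in> gf2.span B" for x
      using b gf2.span_diff[OF _ that, of "b + x"] by auto
    then show ?thesis by blast
  qed
  ultimately show ?case
    using IH insert.hyps by (simp add: card_Un_disjoint card_image)
qed

text \<open>Turns dimensions into cardinalities, so that rank identities can be proved by
  counting.\<close>

lemma gf2_card_subspace:
  assumes "gf2.subspace S" "finite S"
  shows "card S = 2 ^ gf2.dim S"
proof -
  obtain B where B: "B \<subseteq> S" "gf2.independent B" "S \<subseteq> gf2.span B" "card B = gf2.dim S"
    using gf2.basis_exists by blast
  have "gf2.span B = S"
    using B(1,3) assms(1) gf2.span_minimal by blast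
  then show ?thesis
    using gf2_card_span[of B] B assms(2) finite_subset by metis
qed

lemma gf2_subspace_kernel:
  fixes T :: "('a \<Rightarrow> bit) \<Rightarrow> 'b \<Rightarrow> bit"
  assumes "gf2.subspace A" and add: "\<And>v w. T (v + w) = T v + T w"
  shows "gf2.subspace (gf2_kernel A T)"
proof (rule gf2_subspaceI)
  show "0 \<in> gf2_kernel A T"
    using gf2.subspace_0[OF assms(1)] gf2_additive_0[of T, OF add]
    unfolding gf2_kernel_def by blast
  show "v + w \<in> gf2_kernel A T" if "v \<in> gf2_kernel A T" "w \<in> gf2_kernel A T" for v w
    using that gf2.subspace_add[OF assms(1)] by (simp add: gf2_kernel_def add)
qed

text \<open>All nonempty fibres of an additive map are translates of its kernel.\<close>

lemma gf2_card_kernel_image: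
  fixes T :: "('a \<Rightarrow> bit) \<Rightarrow> 'b \<Rightarrow> bit"
  assumes "finite A" "gf2.subspace A" and add: "\<And>v w. T (v + w) = T v + T w"
  shows "card A = card (gf2_kernel A T) * card (T ` A)"
proof -
  have "card A = (\<Sum>y\<in>T ` A. card {v \<in> A. T v = y})"
    using sum.image_gen[OF assms(1), of "\<lambda>_. 1::nat" T] by simp
  also have "\<dots> = (\<Sum>y\<in>T ` A. card (gf2_kernel A T))"
  proof (rule sum.cong[OF refl])
    fix y assume "y \<in> T ` A"
    then obtain w where w: "w \<in> A" "T w = y" by blast
    \<comment> \<open>In characteristic two a translation is its own inverse.\<close>
    have "bij_betw (\<lambda>v. w + v) (gf2_kernel A T) {v \<in> A. T v = y}"
      by (rule bij_betw_byWitness[where f' = "\<lambda>v. w + v"])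
        (use w gf2.subspace_add[OF assms(2)] in
          \<open>auto simp: gf2_kernel_def add gf2_add_cancel gf2_add_self\<close>)
    then show "card {v \<in> A. T v = y} = card (gf2_kernel A T)"
      by (rule bij_betw_same_card[symmetric])
  qed
  finally show ?thesis by simp
qed

lemma gf2_card_image:
  fixes T :: "('a \<Rightarrow> bit) \<Rightarrow> 'b \<Rightarrow> bit"
  assumes "finite A" "gf2.subspace A" and add: "\<And>v w. T (v + w) = T v + T w"
  shows "card (T ` A) = 2 ^ gf2_rank A T"
  unfolding gf2_rank_def
proof (rule gf2_card_subspace)
  show "gf2.subspace (T ` A)"
  proof (rule gf2_subspaceI)
    have "T 0 \<in> T ` A" using gf2.subspace_0[OF assms(2)] by (rule imageI)
    then show "0 \<in> T ` A" unfolding gf2_additive_0[of T, OF add] .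
    fix y z assume "y \<in> T ` A" "z \<in> T ` A"
    then obtain v w where vw: "v \<in> A" "w \<in> A" "y = T v" "z = T w" by blast
    then have "T (v + w) \<in> T ` A" using gf2.subspace_add[OF assms(2)] by blast
    then show "y + z \<in> T ` A" by (simp only: add vw)
  qed
qed (use assms(1) in simp)

lemma gf2_vecs_0: "0 \<in> gf2_vecs X"
  by (simp add: gf2_vecs_def)

lemma gf2_vecs_add: "v \<in> gf2_vecs X \<Longrightarrow> w \<in> gf2_vecs X \<Longrightarrow> v + w \<in> gf2_vecs X"
  by (simp add: gf2_vecs_def)

lemma gf2_subspace_vecs: "gf2.subspace (gf2_vecs X)"
  by (rule gf2_subspaceI) (rule gf2_vecs_0, rule gf2_vecs_add)

lemma gf2_vecs_mono: "X \<subseteq> Y \<Longrightarrow> gf2_vecs X \<subseteq> gf2_vecs Y"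
  by (auto simp: gf2_vecs_def)

lemma restr_in_gf2_vecs: "restr v X \<in> gf2_vecs X"
  by (simp add: gf2_vecs_def restr_def)

lemma restr_add: "restr (v + w) X = restr v X + restr w X"
  by (auto simp: restr_def)

lemma restr_id: "v \<in> gf2_vecs X \<Longrightarrow> restr v X = v"
  by (auto simp: restr_def gf2_vecs_def)

lemma bij_betw_supp: "bij_betw supp (gf2_vecs X) (Pow X)"
proof (rule bij_betw_byWitness[where f' = indic])
  show "\<forall>v\<in>gf2_vecs X. indic (supp v) = v"
    by (auto simp: indic_def supp_def)
qed (auto simp: indic_def supp_def gf2_vecs_def)

lemma
  assumes "finite X"
  shows finite_gf2_vecs: "finite (gf2_vecs X)" and card_gf2_vecs: "card (gf2_vecs X) = 2 ^ card X"
  using bij_betw_supp[of X] assms bij_betw_finite[OF bij_betw_supp, of X]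
  by (auto simp: card_Pow dest: bij_betw_same_card)

lemma sum_apply: "(\<Sum>g\<in>A. f g) x = (\<Sum>g\<in>A. f g x)"
  by (induction A rule: infinite_finite_induct) simp_all

section \<open>Orientation and mirror images\<close>

text \<open>Linearity in column \<open>t\<close> is linearity in row \<open>t\<close> of the
  transpose, which has the same determinant.\<close>

lemma det_column_combination:
  fixes w :: "'k::finite \<Rightarrow> real^'k"
  shows "det (\<chi> r c. (if c = t then u + a *\<^sub>R v else w c) $ r) =
    det (\<chi> r c. (if c = t then u else w c) $ r) + a * det (\<chi> r c. (if c = t then v else w c) $ r)"
proof -
  have *: "det (\<chi> r c. (if c = t then y else w c) $ r) = det (\<chi> c. if c = t then y else w c)" for y
  proof -
    have "(\<chi> r c. (if c = t then y else w c) $ r) = transpose (\<chi> c. if c = t then y else w c)"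
      by (simp add: transpose_def vec_eq_iff)
    then show ?thesis by simp
  qed
  show ?thesis
    using det_row_add[of t "\<lambda>_. u" "\<lambda>_. a *s v" w] det_row_mul[of t a "\<lambda>_. v" w]
    unfolding * scalar_mult_eq_scaleR by simp
qed

text \<open>The nonzero vector \<open>d\<close> lies in the kernel of the transpose.\<close>

lemma det_orthogonal_columns_eq_0:
  fixes w :: "'k::finite \<Rightarrow> real^'k"
  assumes "d \<noteq> 0" and "\<And>c. w c \<bullet> d = 0"
  shows "det (\<chi> r c. w c $ r) = 0"
proof -
  have "transpose (\<chi> r c. w c $ r) *v d = 0"
    using assms(2) by (simp add: vec_eq_iff transpose_def matrix_vector_mult_def inner_vec_def)
  then have "\<not> invertible (transpose (\<chi> r c. w c $ r))"
    using assms(1) by (metis invertible_left_inverse matrix_left_invertible_ker)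
  then show ?thesis by (simp add: invertible_det_nz)
qed

lemma det_normal_column_neq_0:
  fixes w :: "'k::finite \<Rightarrow> real^'k"
  assumes "d \<noteq> 0" and "\<And>c. c \<noteq> t \<Longrightarrow> w c \<bullet> d = 0"
    and "inj_on w (UNIV - {t})" and "independent (w ` (UNIV - {t}))"
  shows "det (\<chi> r c. (if c = t then d else w c) $ r) \<noteq> 0"
proof -
  let ?f = "\<lambda>c. if c = t then d else w c"
  let ?A = "\<chi> r c. ?f c $ r"
  \<comment> \<open>Being orthogonal to all other columns, \<open>d\<close> would have to be
    orthogonal to itself.\<close>
  have nd: "d \<notin> span (w ` (UNIV - {t}))"
  proof
    assume "d \<in> span (w ` (UNIV - {t}))"
    then have "orthogonal d d"
      by (rule orthogonal_to_span) (auto simp: orthogonal_def inner_commute dest: assms(2))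
    with assms(1) show False by (simp add: orthogonal_def)
  qed
  have im: "range ?f = insert d (w ` (UNIV - {t}))" by auto
  have inj: "inj ?f"
  proof (rule injI)
    fix a b assume "?f a = ?f b"
    moreover have "w c \<noteq> d" if "c \<noteq> t" for c
      using nd span_base[of "w c" "w ` (UNIV - {t})"] that by auto
    ultimately show "a = b"
      using assms(3) by (auto simp: inj_on_def split: if_splits)
  qed
  have cols: "columns ?A = range ?f"
    by (auto simp: columns_def column_def)
  have "independent (range ?f)"
    unfolding im by (rule independent_insertI[OF nd assms(4)])
  then have "rank ?A = card (range ?f)"
    unfolding column_rank_def cols by (rule dim_eq_card_independent)
  also have "\<dots> = CARD('k)"
    by (rule card_image[OF inj])
  finally have "rank ?A = CARD('k)" .
  then show ?thesis by (simp add: det_eq_0_rank)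
qed

text \<open>The origin and the points \<open>w c\<close> are the centres of the spheres, and
  \<open>p\<close> and \<open>q\<close> their two common points. All centres are equidistant from
  \<open>p\<close> and \<open>q\<close>, so the reflection in the hyperplane orthogonal to
  \<open>p - q\<close> fixes them and swaps \<open>p\<close> with \<open>q\<close>.\<close>

lemma mirror_pair:
  fixes w :: "'k::finite \<Rightarrow> real^'k" and t :: 'k
  defines "D \<equiv> \<lambda>v. det (\<chi> r c. (if c = t then v else w c) $ r)"
  assumes "p \<noteq> q" and same_norm: "norm p = norm q"
    and dist_eq: "\<And>c. c \<noteq> t \<Longrightarrow> dist (w c) p = dist (w c) q"
    and inj: "inj_on w (UNIV - {t})" and indep: "independent (w ` (UNIV - {t}))"
  shows "\<exists>Q. (\<forall>v. norm (Q *v v) = norm v) \<and> det Q = -1 \<and>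
    (\<forall>c. c \<noteq> t \<longrightarrow> Q *v w c = w c) \<and> D q = - D p \<and> D p \<noteq> 0"
proof -
  define d where "d = p - q"
  define m where "m = (1/2) *\<^sub>R (p + q)"
  have d0: "d \<noteq> 0" using \<open>p \<noteq> q\<close> by (simp add: d_def)
  have md: "m \<bullet> d = 0"
    using same_norm by (simp add: m_def d_def norm_eq inner_diff_left inner_diff_right inner_add_left inner_add_right inner_commute)
  have wd: "w c \<bullet> d = 0" if "c \<noteq> t" for c
  proof -
    have "(dist (w c) p)\<^sup>2 = (dist (w c) q)\<^sup>2" using dist_eq[OF that] by simp
    moreover have "p \<bullet> p = q \<bullet> q" using same_norm by (simp add: norm_eq)
    ultimately show ?thesis
      by (simp add: d_def dist_norm power2_norm_eq_inner inner_diff_right inner_diff_left inner_commute)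
  qed
  \<comment> \<open>The midpoint \<open>m\<close> lies in the mirror hyperplane, as do all
    \<open>w c\<close>. By linearity only the components of \<open>p\<close> and \<open>q\<close>
    along \<open>d\<close> count, and these are opposite.\<close>
  have Dm: "D m = 0"
    unfolding D_def using d0 md wd by (intro det_orthogonal_columns_eq_0[of d]) auto
  have Dd: "D d \<noteq> 0"
    unfolding D_def by (rule det_normal_column_neq_0[OF d0 wd inj indep])
  have lin: "D (u + a *\<^sub>R v) = D u + a * D v" for u v a
    unfolding D_def by (rule det_column_combination)
  have halves: "p = m + (1/2) *\<^sub>R d" "q = m + (-1/2) *\<^sub>R d"
    by (simp_all add: m_def d_def vec_eq_iff field_simps)
  have Dp: "D p = D d / 2" and Dq: "D q = - D d / 2"
    by (subst halves, subst lin, simp add: Dm)+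
  \<comment> \<open>The Householder reflection with normal \<open>d\<close>.\<close>
  define R where "R v = v - (2 * (v \<bullet> d) / (d \<bullet> d)) *\<^sub>R d" for v
  have "linear R"
    by (rule linearI) (simp_all add: R_def inner_add_left algebra_simps add_divide_distrib)
  define Q where "Q = matrix R"
  have Q: "Q *v v = R v" for v
    unfolding Q_def using matrix_vector_mul(2)[OF \<open>linear R\<close>] by metis
  have Qnorm: "norm (Q *v v) = norm v" for v
    unfolding Q norm_eq using d0
    by (simp add: R_def inner_diff_left inner_diff_right inner_commute field_simps)
  have Qw: "Q *v w c = w c" if "c \<noteq> t" for c
    using wd[OF that] by (simp add: Q R_def)
  have "p \<bullet> d = d \<bullet> d / 2"
    by (subst halves) (simp add: inner_add_left md)
  then have e: "2 * (p \<bullet> d) = d \<bullet> d" "d \<bullet> d \<noteq> 0"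
    using d0 by simp_all
  have Qp: "Q *v p = q"
    unfolding Q R_def e(1) divide_self[OF e(2)] by (simp add: d_def)
  \<comment> \<open>The reflection carries the columns for \<open>p\<close> to those for
    \<open>q\<close>. Comparing \<open>D q = det Q * D p\<close> with \<open>D q = - D p\<close>
    then yields \<open>det Q\<close> without expanding the matrix.\<close>
  have "(\<chi> r c. (if c = t then q else w c) $ r) = Q ** (\<chi> r c. (if c = t then p else w c) $ r)"
  proof -
    have "(if c = t then q else w c) = Q *v (if c = t then p else w c)" for c
      using Qp Qw by simp
    then show ?thesis
      by (simp add: vec_eq_iff matrix_matrix_mult_def matrix_vector_mult_def)
  qed
  then have "D q = det Q * D p" by (simp add: D_def det_mul)
  then have "(det Q + 1) * D d = 0" using Dp Dq by (simp add: algebra_simps)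
  then have "det Q = -1" using Dd by (simp add: eq_neg_iff_add_eq_0)
  with Qnorm Qw Dp Dq Dd show ?thesis by auto
qed

text \<open>Identifies coordinates with list positions, as the column numbering in
  \<open>orientation\<close> does.\<close>

lemma bij_betw_card_less:
  "bij_betw (\<lambda>c::'k::{finite,linorder}. card {c'. c' < c}) UNIV {..<CARD('k)}"
proof -
  have "card {c'. c' < a} < card {c'. c' < b}" if "a < b" for a b :: 'k
    using that by (intro psubset_card_mono) (auto intro: less_trans)
  then have inj: "inj (\<lambda>c::'k. card {c'. c' < c})"
    unfolding inj_def by (metis less_irrefl linorder_neqE)
  moreover have "range (\<lambda>c::'k. card {c'. c' < c}) \<subseteq> {..<CARD('k)}"
    by (auto intro!: psubset_card_mono)
  ultimately have "range (\<lambda>c::'k. card {c'. c' < c}) = {..<CARD('k)}"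
    by (intro card_subset_eq) (simp_all add: card_image)
  with inj show ?thesis by (simp add: bij_betw_def)
qed

text \<open>Replaces the sorted list by its head \<open>b\<close> and an enumeration
  \<open>f\<close> of the other columns. Both are chosen before \<open>x\<close>, so the
  determinants of different placements can be compared column by column.\<close>

lemma orientation_as_det:
  fixes I :: "'k::{finite,linorder} ddgp"
  assumes "finite (preds I i)" "card (preds I i) = CARD('k)" "i \<notin> preds I i"
  obtains b f where "b \<in> preds I i" "bij_betw f (UNIV :: 'k set) (insert i (preds I i) - {b})"
    "\<And>x. orientation I x i = det (\<chi> r c. (x (f c) - x b) $ r)"
proof -
  define us where "us = sorted_list_of_set (preds I i)"
  have us: "set us = preds I i" "distinct us" "length us = CARD('k)"
    using assms by (simp_all add: us_def)
  then obtain b vs where bvs: "us = b # vs"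
    by (metis length_0_conv neq_Nil_conv zero_less_card_finite less_irrefl)
  define f where "f c = (vs @ [i]) ! card {c'. c' < c}" for c :: 'k
  have "bij_betw ((!) (vs @ [i])) {..<CARD('k)} (set (vs @ [i]))"
    by (rule bij_betw_nth) (use us assms(3) bvs in auto)
  then have "bij_betw f UNIV (set (vs @ [i]))"
    unfolding f_def by (rule bij_betw_trans[OF bij_betw_card_less, unfolded o_def])
  moreover have "set (vs @ [i]) = insert i (preds I i) - {b}"
    using us bvs assms(3) by auto
  moreover have "orientation I x i = det (\<chi> r c. (x (f c) - x b) $ r)" for x
  proof -
    have "card {c'. c' < c} < length (vs @ [i])" for c :: 'k
      using bij_betw_card_less us(3) bvs unfolding bij_betw_def by auto
    then have "map (\<lambda>v. x v - x b) (vs @ [i]) ! card {c'. c' < c} = x (f c) - x b" for c :: 'k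
      unfolding f_def by (rule nth_map)
    moreover have "orientation I x i =
        det (\<chi> r c. (map (\<lambda>v. x v - x b) (vs @ [i]) ! card {c'. c' < c}) $ r)"
      unfolding orientation_def Let_def us_def[symmetric] bvs by simp
    ultimately show ?thesis by simp
  qed
  ultimately show thesis using us(1) bvs by (intro that[of b f]) auto
qed

section \<open>Embeddings\<close>

lemma ordered_instance_preds:
  fixes I :: "'k::finite ddgp"
  assumes "ordered_instance I" "i \<in> branch_verts I"
  shows "finite (preds I i)" "card (preds I i) = CARD('k)" "i \<notin> preds I i"
    "preds I i \<subseteq> verts I" "\<And>u. u \<in> preds I i \<Longrightarrow> u < i"
proof -
  have *: "i \<in> verts I" "preds I i \<subseteq> {1..i - 1}" "card (preds I i) = CARD('k)"
    using assms by (auto simp: ordered_instance_def branch_verts_def)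
  show "finite (preds I i)" using *(2) finite_subset by blast
  show "card (preds I i) = CARD('k)" by fact
  show less: "u < i" if "u \<in> preds I i" for u using *(2) that by fastforce
  show "i \<notin> preds I i" using less by blast
  show "preds I i \<subseteq> verts I" using *(1,2) by (fastforce simp: verts_def)
qed

lemma lateration_cong:
  assumes "\<And>u. u \<in> preds I i \<Longrightarrow> x u = y u"
  shows "lateration I x i = lateration I y i"
  using assms by (simp add: lateration_def)

lemma orientation_cong:
  fixes I :: "'k::{finite,linorder} ddgp"
  assumes "ordered_instance I" "i \<in> branch_verts I"
    and eq: "x i = y i" "\<And>u. u \<in> preds I i \<Longrightarrow> x u = y u"
  shows "orientation I x i = orientation I y i"
proof -
  obtain b and f :: "'k \<Rightarrow> nat" where b: "b \<in> preds I i"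
    and f: "bij_betw f UNIV (insert i (preds I i) - {b})"
    and o: "\<And>x. orientation I x i = det (\<chi> r c. (x (f c) - x b) $ r)"
    using orientation_as_det ordered_instance_preds(1-3)[OF assms(1,2)] by metis
  have "x (f c) = y (f c)" for c
    using bij_betw_apply[OF f, of c] eq by auto
  then show ?thesis using eq(2)[OF b] by (simp add: o)
qed

text \<open>The sign test made in \<open>place\<close>, named so that flipping a bit can be traded
  for reversing an orientation.\<close>

definition on_side :: "bit \<Rightarrow> real \<Rightarrow> bool" where
  "on_side b r \<longleftrightarrow> (if b = 0 then 0 < r else r < 0)"

lemma on_side_minus: "r \<noteq> 0 \<Longrightarrow> on_side b (- r) \<longleftrightarrow> \<not> on_side b r"
  by (auto simp: on_side_def)

lemma on_side_flip: "b \<noteq> b' \<Longrightarrow> on_side b' (- r) \<longleftrightarrow> on_side b r"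
  by (cases b; cases b') (auto simp: on_side_def)

lemma fold_place_notin:
  fixes I :: "'k::{finite,linorder} ddgp"
  shows "v \<notin> set js \<Longrightarrow> fold (place I s) js x v = x v"
  by (induction js arbitrary: x) (auto simp: place_def)

lemma embed_seed:
  fixes I :: "'k::{finite,linorder} ddgp"
  assumes "i \<in> seed_verts I"
  shows "embed I s i = seed I i"
  using assms by (simp add: embed_def fold_place_notin seed_verts_def)

text \<open>The predecessors of \<open>i\<close> come before \<open>i\<close> and later steps change
  neither them nor \<open>i\<close>. Hence the choice made at step \<open>i\<close> can be read off
  from the finished embedding, and the fold disappears from later arguments.\<close>

lemma embed_branch_eq:
  fixes I :: "'k::{finite,linorder} ddgp"
  assumes "ordered_instance I" "i \<in> branch_verts I"
  shows "embed I s i = (THE y. y \<in> lateration I (embed I s) i \<and>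
    on_side (s i) (orientation I ((embed I s)(i := y)) i))"
proof -
  let ?x = "fold (place I s) [CARD('k) + 1..<i] (seed I)"
  have "CARD('k) + 1 \<le> i" "i < nverts I + 1"
    using assms(2) by (auto simp: branch_verts_def verts_def seed_verts_def)
  then have "[CARD('k) + 1..<nverts I + 1] = [CARD('k) + 1..<i] @ i # [i + 1..<nverts I + 1]"
    using upt_add_eq_append[of "CARD('k) + 1" i "nverts I + 1 - i"] upt_conv_Cons[of i "nverts I + 1"]
    by simp
  then have e: "embed I s = fold (place I s) [i + 1..<nverts I + 1] (place I s i ?x)"
    by (simp add: embed_def)
  have less: "embed I s v = ?x v" if "v < i" for v
    using that by (simp add: e fold_place_notin place_def)
  have "lateration I ?x i = lateration I (embed I s) i"
    using ordered_instance_preds(5)[OF assms] less by (intro lateration_cong) simp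
  moreover have "orientation I (?x(i := y)) i = orientation I ((embed I s)(i := y)) i" for y
    using ordered_instance_preds(5)[OF assms] less
    by (intro orientation_cong[OF assms]) auto
  moreover have "embed I s i = place I s i ?x i"
    by (simp add: e fold_place_notin)
  ultimately show ?thesis by (simp add: place_def on_side_def cong: if_cong)
qed

text \<open>Moving a predecessor \<open>b\<close> to the origin reduces this to
  \<open>mirror_pair\<close>. \<open>Q\<close> is the linear part of the reflection across the
  hyperplane of the centres, so what it fixes are differences of centres.\<close>

lemma lateration_mirror:
  fixes I :: "'k::{finite,linorder} ddgp" and x :: "nat \<Rightarrow> real^('k::{finite,linorder})"
  assumes "ordered_instance I" "i \<in> branch_verts I"
    and "inj_on x (preds I i)" "\<not> affine_dependent (x ` preds I i)" "card (lateration I x i) = 2"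
  obtains p q Q where "lateration I x i = {p, q}"
    "orientation I (x(i := q)) i = - orientation I (x(i := p)) i"
    "orientation I (x(i := p)) i \<noteq> 0"
    "\<And>v. norm (Q *v v) = norm v" "det Q = -1"
    "\<And>u v. u \<in> preds I i \<Longrightarrow> v \<in> preds I i \<Longrightarrow> Q *v (x u - x v) = x u - x v"
proof -
  note P = ordered_instance_preds[OF assms(1,2)]
  obtain p q where pq: "lateration I x i = {p, q}" "p \<noteq> q"
    using assms(5) by (auto simp: card_2_iff)
  have "p \<in> lateration I x i" "q \<in> lateration I x i"
    by (simp_all add: pq)
  then have dist: "dist (x u) p = dist (x u) q" if "u \<in> preds I i" for u
    using that by (auto simp: lateration_def)
  obtain b and f :: "'k \<Rightarrow> nat" where b: "b \<in> preds I i"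
    and f: "bij_betw f UNIV (insert i (preds I i) - {b})"
    and o: "\<And>x. orientation I x i = det (\<chi> r c. (x (f c) - x b) $ r)"
    using orientation_as_det P(1-3) by metis
  have "i \<noteq> b" using b P(3) by blast
  \<comment> \<open>\<open>t\<close> is the column holding the new vertex, the only one that varies
    with the candidate point.\<close>
  then obtain t where t: "f t = i"
    using f by (metis bij_betw_iff_bijections Diff_iff empty_iff insert_iff)
  have ft: "f c = i \<longleftrightarrow> c = t" for c
    using f t by (metis UNIV_I bij_betw_def inj_onD)
  have f_im: "f ` (UNIV - {t}) = preds I i - {b}"
  proof -
    have "f ` (UNIV - {t}) = range f - {i}"
      using f t by (simp add: bij_betw_def inj_on_image_set_diff[of f UNIV])
    then show ?thesis using f P(3) \<open>i \<noteq> b\<close> by (auto simp: bij_betw_def)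
  qed
  define w where "w c = x (f c) - x b" for c
  have oy: "orientation I (x(i := y)) i = det (\<chi> r c. (if c = t then y - x b else w c) $ r)" for y
    using \<open>i \<noteq> b\<close> ft by (auto simp: o w_def intro!: arg_cong[of _ _ det] simp: vec_eq_iff)
  have w_im: "w ` (UNIV - {t}) = (\<lambda>y. - x b + y) ` (x ` preds I i - {x b})"
  proof -
    have "x ` preds I i - {x b} = x ` (preds I i - {b})"
      using assms(3) b by (auto simp: inj_on_def)
    also have "\<dots> = (x \<circ> f) ` (UNIV - {t})"
      by (simp add: f_im flip: image_image)
    finally show ?thesis by (auto simp: w_def image_image)
  qed
  \<comment> \<open>Affine independence of the centres is linear independence of their differences
    from \<open>x b\<close>.\<close>
  have indep: "independent (w ` (UNIV - {t}))"
    unfolding w_im using assms(4) affine_dependent_iff_dependent2[of "x b" "x ` preds I i"] b by auto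
  have inj: "inj_on w (UNIV - {t})"
  proof -
    have "inj_on (x \<circ> f) (UNIV - {t})"
      using f f_im assms(3)
      by (intro comp_inj_on) (auto simp: bij_betw_def intro: inj_on_subset)
    then show ?thesis by (simp add: w_def inj_on_def)
  qed
  have wdist: "dist (w c) (p - x b) = dist (w c) (q - x b)" if "c \<noteq> t" for c
    using that dist[of "f c"] f_im by (auto simp: w_def dist_norm)
  have wnorm: "norm (p - x b) = norm (q - x b)"
    using dist[OF b] by (simp add: dist_norm norm_minus_commute)
  have "p - x b \<noteq> q - x b" using pq(2) by simp
  then obtain Q where Q: "\<And>v. norm (Q *v v) = norm v" "det Q = -1"
    "\<And>c. c \<noteq> t \<Longrightarrow> Q *v w c = w c"
    "orientation I (x(i := q)) i = - orientation I (x(i := p)) i"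
    "orientation I (x(i := p)) i \<noteq> 0"
    unfolding oy using mirror_pair[OF _ wnorm wdist inj indep] by blast
  have Qb: "Q *v (x u - x b) = x u - x b" if "u \<in> preds I i" for u
  proof (cases "u = b")
    case False
    then have "u \<in> f ` (UNIV - {t})" using that f_im by simp
    then obtain c where "c \<noteq> t" "u = f c" by blast
    then show ?thesis using Q(3)[of c] by (simp add: w_def)
  qed simp
  have "Q *v (x u - x v) = x u - x v" if "u \<in> preds I i" "v \<in> preds I i" for u v
    using Qb[OF that(1)] Qb[OF that(2)] matrix_vector_mult_diff_distrib[of Q "x u - x b" "x v - x b"]
    by simp
  then show thesis by (rule that[OF pq(1) Q(4,5,1,2)])
qed

section \<open>Embeddings under nondegeneracy\<close>

context
  fixes I :: "'k::{finite,linorder} ddgp"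
  assumes ord: "ordered_instance I" and nondeg: "nondegenerate I"
begin

lemma nondegenerateD:
  assumes "s \<in> gf2_vecs (branch_verts I)" "i \<in> branch_verts I"
  shows "inj_on (embed I s) (preds I i)" "\<not> affine_dependent (embed I s ` preds I i)"
    "card (lateration I (embed I s) i) = 2"
  using nondeg assms by (auto simp: nondegenerate_def)

text \<open>The two candidates have opposite nonzero orientations, so exactly one passes the sign
  test. This licenses the definite description in \<open>place\<close>.\<close>

lemma embed_ex1:
  assumes "s \<in> gf2_vecs (branch_verts I)" "i \<in> branch_verts I"
  shows "\<exists>!y. y \<in> lateration I (embed I s) i \<and>
    on_side (s i) (orientation I ((embed I s)(i := y)) i)"
proof -
  obtain p q where pq: "lateration I (embed I s) i = {p, q}"
    "orientation I ((embed I s)(i := q)) i = - orientation I ((embed I s)(i := p)) i"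
    "orientation I ((embed I s)(i := p)) i \<noteq> 0"
    using lateration_mirror[OF ord assms(2) nondegenerateD[OF assms]] by metis
  then have "on_side (s i) (orientation I ((embed I s)(i := q)) i) \<longleftrightarrow>
      \<not> on_side (s i) (orientation I ((embed I s)(i := p)) i)"
    using on_side_minus by metis
  then show ?thesis unfolding pq(1) by (metis empty_iff insert_iff)
qed

lemma
  assumes "s \<in> gf2_vecs (branch_verts I)" "i \<in> branch_verts I"
  shows embed_lateration: "embed I s i \<in> lateration I (embed I s) i"
    and embed_on_side: "on_side (s i) (orientation I (embed I s) i)"
  using theI'[OF embed_ex1[OF assms]] unfolding embed_branch_eq[OF ord assms(2), symmetric]
  by simp_all

lemma embed_eqI:
  assumes "s \<in> gf2_vecs (branch_verts I)" "i \<in> branch_verts I"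
    and "y \<in> lateration I (embed I s) i" "on_side (s i) (orientation I ((embed I s)(i := y)) i)"
  shows "embed I s i = y"
  unfolding embed_branch_eq[OF ord assms(2)]
  by (rule the1_equality[OF embed_ex1]) (use assms in auto)

lemma embed_step_cong:
  assumes s: "s \<in> gf2_vecs (branch_verts I)" and s': "s' \<in> gf2_vecs (branch_verts I)"
    and i: "i \<in> branch_verts I" and "s' i = s i"
    and pre: "\<And>u. u \<in> preds I i \<Longrightarrow> embed I s' u = embed I s u"
  shows "embed I s' i = embed I s i"
proof (rule embed_eqI[OF s' i])
  show "embed I s i \<in> lateration I (embed I s') i"
    using embed_lateration[OF s i] pre by (simp add: lateration_def)
  have "orientation I ((embed I s')(i := embed I s i)) i = orientation I (embed I s) i"
    using pre by (intro orientation_cong[OF ord i]) auto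
  then show "on_side (s' i) (orientation I ((embed I s')(i := embed I s i)) i)"
    using embed_on_side[OF s i] \<open>s' i = s i\<close> by simp
qed

text \<open>Induction along the vertex order: on a set closed under predecessors, every position is
  determined by seeds and bits inside the set.\<close>

lemma embed_cong:
  assumes s: "s \<in> gf2_vecs (branch_verts I)" and s': "s' \<in> gf2_vecs (branch_verts I)"
    and "A \<subseteq> verts I" and closed: "\<And>i. i \<in> A \<inter> branch_verts I \<Longrightarrow> preds I i \<subseteq> A"
    and agree: "\<And>i. i \<in> A \<inter> branch_verts I \<Longrightarrow> s' i = s i"
    and "a \<in> A"
  shows "embed I s' a = embed I s a"
  using \<open>a \<in> A\<close>
proof (induction a rule: less_induct)
  case (less a)
  show ?case
  proof (cases "a \<in> branch_verts I")
    case True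
    have pre: "embed I s' u = embed I s u" if "u \<in> preds I a" for u
      using less closed[of a] ordered_instance_preds(5)[OF ord True that] that True by blast
    show ?thesis
    proof (rule embed_step_cong[OF s s' True _ pre])
      show "s' a = s a" using agree less.prems True by blast
    qed
  next
    case False
    then have "a \<in> seed_verts I" using less.prems \<open>A \<subseteq> verts I\<close> by (auto simp: branch_verts_def)
    then show ?thesis by (simp add: embed_seed)
  qed
qed

text \<open>\<open>R\<close> is the affine reflection with linear part \<open>Q\<close>. By
  induction, the predecessors of a flipped vertex have all been moved by \<open>R\<close>, either as
  members of \<open>T\<close> or as fixed points in \<open>C\<close>, so the image of its old
  position lies on the new spheres with reversed orientation, as the flipped bit demands.
  Predecessors of an unflipped vertex stay put, and so does the vertex.\<close>

lemma embed_flip: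
  assumes s: "s \<in> gf2_vecs (branch_verts I)" and s': "s' \<in> gf2_vecs (branch_verts I)"
    and "A \<subseteq> verts I" and closed: "\<And>i. i \<in> A \<inter> branch_verts I \<Longrightarrow> preds I i \<subseteq> A"
    and "T \<subseteq> A \<inter> branch_verts I"
    and flip: "\<And>i. i \<in> A \<inter> branch_verts I \<Longrightarrow> s' i \<noteq> s i \<longleftrightarrow> i \<in> T"
    and Q: "\<And>v. norm (Q *v v) = norm v" "det Q = -1"
    and R: "\<And>v w. R v - R w = Q *v (v - w)"
    and fixed: "\<And>u. u \<in> C \<Longrightarrow> R (embed I s u) = embed I s u"
    and inside: "\<And>i. i \<in> T \<Longrightarrow> preds I i \<subseteq> T \<union> C"
    and outside: "\<And>i. i \<in> A \<inter> branch_verts I - T \<Longrightarrow> preds I i \<inter> T = {}"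
    and "a \<in> A"
  shows "embed I s' a = (if a \<in> T then R (embed I s a) else embed I s a)"
  using \<open>a \<in> A\<close>
proof (induction a rule: less_induct)
  case (less a)
  show ?case
  proof (cases "a \<in> branch_verts I")
    case True
    have pre: "embed I s' u = (if u \<in> T then R (embed I s u) else embed I s u)" if "u \<in> preds I a" for u
      using less closed[of a] ordered_instance_preds(5)[OF ord True that] that True by blast
    have lat: "dist (embed I s u) (embed I s a) = len I {u, a}" if "u \<in> preds I a" for u
      using embed_lateration[OF s True] that by (simp add: lateration_def)
    show ?thesis
    proof (cases "a \<in> T")
      case aT: True
      have pre': "embed I s' u = R (embed I s u)" if "u \<in> preds I a" for u
        using pre[OF that] inside[OF aT] that fixed[of u] by auto
      have "embed I s' a = R (embed I s a)"
      proof (rule embed_eqI[OF s' True])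
        show "R (embed I s a) \<in> lateration I (embed I s') a"
          using lat pre' by (simp add: lateration_def dist_norm R Q(1))
        obtain b and f :: "'k \<Rightarrow> nat" where b: "b \<in> preds I a"
          and f: "bij_betw f UNIV (insert a (preds I a) - {b})"
          and o: "\<And>x. orientation I x a = det (\<chi> r c. (x (f c) - x b) $ r)"
          using orientation_as_det ordered_instance_preds(1-3)[OF ord True] by metis
        have "orientation I ((embed I s')(a := R (embed I s a))) a = orientation I (\<lambda>v. R (embed I s v)) a"
          using pre' by (intro orientation_cong[OF ord True]) auto
        \<comment> \<open>Differences of images under \<open>R\<close> are images of differences
          under \<open>Q\<close>, so \<open>Q\<close> factors out of the matrix of columns.\<close>
        also have "\<dots> = det (Q ** (\<chi> r c. (embed I s (f c) - embed I s b) $ r))"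
          by (auto simp: o R matrix_matrix_mult_def matrix_vector_mult_def vec_eq_iff
              intro!: arg_cong[of _ _ det])
        also have "\<dots> = - orientation I (embed I s) a"
          by (simp add: det_mul Q(2) o)
        finally have "orientation I ((embed I s')(a := R (embed I s a))) a = - orientation I (embed I s) a" .
        moreover have "s a \<noteq> s' a" using flip[of a] less.prems True aT by auto
        ultimately show "on_side (s' a) (orientation I ((embed I s')(a := R (embed I s a))) a)"
          using embed_on_side[OF s True] by (simp only: on_side_flip)
      qed
      with aT show ?thesis by simp
    next
      case aT: False
      have pre': "embed I s' u = embed I s u" if "u \<in> preds I a" for u
        using pre[OF that] outside[of a] less.prems True aT that by auto
      have "embed I s' a = embed I s a"
      proof (rule embed_step_cong[OF s s' True _ pre'])
        show "s' a = s a" using flip less.prems True aT by blast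
      qed
      with aT show ?thesis by simp
    qed
  next
    case False
    then have "a \<in> seed_verts I" using less.prems \<open>A \<subseteq> verts I\<close> by (auto simp: branch_verts_def)
    with False \<open>T \<subseteq> A \<inter> branch_verts I\<close> show ?thesis by (auto simp: embed_seed)
  qed
qed

end

section \<open>Clique masks and active edges\<close>

text \<open>The rules for \<open>in_Fix\<close> extend a chain at its start; this extends it at its
  end, which makes the active vertices closed under predecessors.\<close>

lemma in_Fix_preds: "in_Fix I i j \<Longrightarrow> u \<in> preds I j \<Longrightarrow> in_Fix I i u"
  by (induction rule: in_Fix.induct) (auto intro: in_Fix.intros)

lemma active_verts_preds: "i \<in> active_verts I \<Longrightarrow> preds I i \<subseteq> active_verts I"
  by (auto simp: active_verts_def Fix_def intro: in_Fix_preds)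

text \<open>The contribution of a single mirror clique to \<open>mask_map\<close>. The nested
  comprehension has the shape produced by \<open>sum.group\<close>.\<close>

definition clique_mask :: "('k :: finite) ddgp \<Rightarrow> (gen_label \<Rightarrow> bit) \<Rightarrow> nat set \<Rightarrow> nat \<Rightarrow> bit" where
  "clique_mask I \<alpha> C = (\<Sum>g\<in>{g \<in> {g \<in> gens I. \<alpha> g = 1}. mirror I g = C}. mask I g)"

lemma mask_map_apply:
  assumes "finite (gens I)"
  shows "mask_map I \<alpha> v = (\<Sum>g\<in>gens I. \<alpha> g * mask I g v)"
  unfolding mask_map_def sum_apply
  by (rule sum.mono_neutral_cong_left) (use assms in auto)

lemma viol_map_add: "viol_map I (\<alpha> + \<beta>) = viol_map I \<alpha> + viol_map I \<beta>"
proof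
  fix r show "viol_map I (\<alpha> + \<beta>) r = (viol_map I \<alpha> + viol_map I \<beta>) r"
    by (cases "r \<in> viol_rows I")
      (simp_all only: viol_map_def plus_fun_apply distrib_left sum.distrib if_True if_False add_0)
qed

lemma mask_map_add:
  assumes "finite (gens I)"
  shows "mask_map I (\<alpha> + \<beta>) = mask_map I \<alpha> + mask_map I \<beta>"
  by (rule ext) (simp only: mask_map_apply[OF assms] plus_fun_apply distrib_right sum.distrib)

lemma stacked_map_add:
  assumes "finite (gens I)"
  shows "stacked_map I (\<alpha> + \<beta>) = stacked_map I \<alpha> + stacked_map I \<beta>"
  by (simp add: stacked_map_def mask_map_add[OF assms] viol_map_add fun_eq_iff split: sum.split)

text \<open>A common view of cone and base generators: every masked vertex lies in the cone of a
  constrained vertex whose predecessor set is the mirror.\<close>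

lemma mask_mirror_cases:
  assumes "g \<in> gens I"
  shows "mirror I g \<in> preds I ` constrained I"
    and "mask I g v = 1 \<Longrightarrow> v \<in> constrained I \<and>
      (\<exists>w\<in>constrained I. preds I w = mirror I g \<and> v \<in> Cone I w)"
proof -
  show "mirror I g \<in> preds I ` constrained I"
    using assms by (auto simp: gens_def mirror_def)
  show "v \<in> constrained I \<and> (\<exists>w\<in>constrained I. preds I w = mirror I g \<and> v \<in> Cone I w)"
    if "mask I g v = 1"
    using assms that
    by (cases g) (force simp: gens_def mirror_def mask_def indic_def split: if_splits)+
qed

text \<open>Kernel times image is counted for V, for the stacked map, and for M on the kernel of V.
  The kernel in the third count is that of the stacked map and cancels.\<close>

lemma mirror_space_card:
  assumes "finite (gens I)"
  shows "card (mirror_space I) = 2 ^ (gf2_rank (gen_space I) (stacked_map I) - gf2_rank (gen_space I) (viol_map I))"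
    and "gf2_rank (gen_space I) (viol_map I) \<le> gf2_rank (gen_space I) (stacked_map I)"
proof -
  let ?A = "gen_space I" and ?K = "gf2_kernel (gen_space I) (viol_map I)"
  let ?rV = "gf2_rank ?A (viol_map I)" and ?rS = "gf2_rank ?A (stacked_map I)"
  note M = mask_map_add[OF assms] and S = stacked_map_add[OF assms] and V = viol_map_add[of I]
  have A: "finite ?A" "gf2.subspace ?A"
    using assms by (simp_all add: gen_space_def finite_gf2_vecs gf2_subspace_vecs)
  have K: "finite ?K" "gf2.subspace ?K"
    using A gf2_subspace_kernel[OF A(2) V] by (simp_all add: gf2_kernel_def)
  have "card ?A = card ?K * 2 ^ ?rV"
    using gf2_card_kernel_image[OF A V] gf2_card_image[OF A V] by simp
  moreover have "card ?A = card (gf2_kernel ?A (stacked_map I)) * 2 ^ ?rS"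
    using gf2_card_kernel_image[OF A S] gf2_card_image[OF A S] by simp
  moreover have "card ?K = card (gf2_kernel ?K (mask_map I)) * card (mirror_space I)"
    unfolding mirror_space_def by (rule gf2_card_kernel_image[OF K M])
  moreover have "gf2_kernel ?K (mask_map I) = gf2_kernel ?A (stacked_map I)"
    by (auto simp: gf2_kernel_def stacked_map_def fun_eq_iff split: sum.splits)
  moreover have "0 \<in> gf2_kernel ?A (stacked_map I)"
    using gf2.subspace_0[OF gf2_subspace_kernel[OF A(2) S]] .
  then have "card (gf2_kernel ?A (stacked_map I)) > 0"
    using A(1) by (auto simp: card_gt_0_iff gf2_kernel_def)
  ultimately have e: "2 ^ ?rS = card (mirror_space I) * 2 ^ ?rV"
    by (simp add: mult.assoc)
  \<comment> \<open>Positivity gives the rank inequality, which makes the truncated subtraction of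
    ranks a true difference.\<close>
  then have "card (mirror_space I) > 0" by (cases "card (mirror_space I)") simp_all
  then have "(2::nat) ^ ?rV \<le> 2 ^ ?rS" unfolding e by simp
  then show le: "?rV \<le> ?rS" by simp
  then have "(2::nat) ^ ?rS = 2 ^ (?rS - ?rV) * 2 ^ ?rV"
    by (simp flip: power_add)
  with e show "card (mirror_space I) = 2 ^ (?rS - ?rV)" by simp
qed

section \<open>Active edges and the summed masks of a clique\<close>

context
  fixes I :: "'k::finite ddgp"
  assumes ord: "ordered_instance I"
begin

lemma verts_preds: "i \<in> verts I \<Longrightarrow> preds I i \<subseteq> verts I"
  using ordered_instance_preds(4)[OF ord, of i] ord
  by (cases "i \<in> seed_verts I") (auto simp: branch_verts_def ordered_instance_def)

lemma edge_verts:
  assumes "{a, b} \<in> edges I"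
  shows "a \<in> verts I" "b \<in> verts I" "a \<noteq> b"
proof -
  have "{a, b} \<in> {{a, b} | a b. a \<in> verts I \<and> b \<in> verts I \<and> a \<noteq> b}"
    using assms ord unfolding ordered_instance_def by blast
  then show "a \<in> verts I" "b \<in> verts I" "a \<noteq> b"
    by (auto simp: doubleton_eq_iff)
qed

lemma disc_edges_subset: "disc_edges I \<subseteq> edges I"
  using ord unfolding disc_edges_def ordered_instance_def clique_def branch_verts_def by blast

lemma active_edges_subset: "active_edges I \<subseteq> edges I"
  using disc_edges_subset by (auto simp: active_edges_def prune_edges_def)

lemma active_verts_subset: "active_verts I \<subseteq> verts I"
proof -
  have "j \<in> verts I" if "in_Fix I i j" "i \<in> verts I" for i j
    using that by (induction rule: in_Fix.induct) (use verts_preds in auto)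
  moreover have "i \<in> verts I" if "e \<in> edges I" "i \<in> e" for e i
    using that ord unfolding ordered_instance_def by blast
  ultimately show ?thesis by (auto simp: active_verts_def Fix_def prune_edges_def)
qed

lemma constrained_eq: "constrained I = active_verts I \<inter> branch_verts I"
  using active_verts_subset by (auto simp: constrained_def branch_verts_def)

lemma finite_constrained: "finite (constrained I)"
  using active_verts_subset by (auto simp: constrained_def verts_def intro: finite_subset)

lemma finite_gens: "finite (gens I)"
  using finite_constrained by (simp add: gens_def)

lemma active_edge_verts:
  assumes "{a, b} \<in> active_edges I"
  shows "a \<in> active_verts I" "b \<in> active_verts I"
  using assms in_Fix.self[of I a] in_Fix.self[of I b]
  unfolding active_edges_def active_verts_def Fix_def by blast+

text \<open>Active vertices are closed under predecessors. Through these edges the violation rows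
  also control how a mask meets the predecessor sets.\<close>

lemma pred_edge_active:
  assumes "i \<in> constrained I" "u \<in> preds I i"
  shows "{u, i} \<in> active_edges I"
  using assms active_verts_preds[of i I]
  by (auto simp: active_edges_def disc_edges_def constrained_eq)

lemma Cone_le: "j \<in> Cone I i \<Longrightarrow> i \<le> j"
  unfolding Cone_def mem_Collect_eq
proof (induction rule: in_Cone.induct)
  case (step w i j)
  \<comment> \<open>Seeds have no predecessors, so \<open>w\<close> is a branch vertex and
    \<open>i\<close> precedes it.\<close>
  then have "w \<in> branch_verts I"
    using ord by (auto simp: branch_verts_def ordered_instance_def)
  then show ?case using step ordered_instance_preds(5)[OF ord] by fastforce
qed simp

text \<open>The mirror precedes the vertices \<open>w\<close> that it places, and a cone contains
  nothing below its apex. In particular mask and mirror are disjoint.\<close>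

lemma mask_above_mirror:
  assumes "g \<in> gens I" "mask I g v = 1" "c \<in> mirror I g"
  shows "c < v"
proof -
  obtain w where "w \<in> constrained I" "preds I w = mirror I g" "v \<in> Cone I w"
    using mask_mirror_cases[OF assms(1)] assms(2) by blast
  then show ?thesis
    using Cone_le[of v w] ordered_instance_preds(5)[OF ord, of w c] assms(3) by (auto simp: constrained_eq)
qed

lemma clique_mask_support:
  assumes "clique_mask I \<alpha> C v = 1"
  shows "v \<in> constrained I" "\<And>c. c \<in> C \<Longrightarrow> c < v"
proof -
  obtain g where "g \<in> gens I" "mirror I g = C" "mask I g v = 1"
    using assms unfolding clique_mask_def sum_apply
    using sum.neutral[of "{g \<in> {g \<in> gens I. \<alpha> g = 1}. mirror I g = C}" "\<lambda>g. mask I g v"] by fastforce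
  then show "v \<in> constrained I" "\<And>c. c \<in> C \<Longrightarrow> c < v"
    using mask_mirror_cases(2) mask_above_mirror by blast+
qed

lemma clique_mask_in_gf2_vecs: "clique_mask I \<alpha> C \<in> gf2_vecs (constrained I)"
  using clique_mask_support(1) by (force simp: gf2_vecs_def)

lemma mask_map_clique_masks:
  "mask_map I \<alpha> = (\<Sum>C\<in>preds I ` constrained I. clique_mask I \<alpha> C)"
  unfolding mask_map_def clique_mask_def
  by (rule sum.group[symmetric]) (use finite_gens finite_constrained mask_mirror_cases(1) in auto)

text \<open>For an edge missing \<open>C\<close>, a generator with mirror \<open>C\<close> violates it exactly if it cuts it.
  So the rows of \<open>C\<close> in the violation matrix test the sum of all masks with mirror \<open>C\<close>, even
  though the individual generators may violate edges.\<close>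

lemma clique_mask_constant:
  assumes \<alpha>: "viol_map I \<alpha> = 0" and e: "{a, b} \<in> active_edges I" and "a \<notin> C" "b \<notin> C"
  shows "clique_mask I \<alpha> C a = clique_mask I \<alpha> C b"
proof -
  have "a \<noteq> b" using e active_edges_subset edge_verts(3) by blast
  \<comment> \<open>The endpoint outside the mask is not in \<open>C\<close>, so the second
    condition of \<open>violates\<close> holds by itself. The sum of two bits is their exclusive
    or.\<close>
  have entry: "viol_entry I ({a, b}, C) g = (if mirror I g = C then mask I g a + mask I g b else 0)" for g
  proof -
    have "{a, b} \<inter> supp (mask I g) =
        (if mask I g a = 1 then {a} else {}) \<union> (if mask I g b = 1 then {b} else {})"
      by (auto simp: supp_def)
    then have "mirror I g = C \<Longrightarrow> violates I g {a, b} \<longleftrightarrow> mask I g a \<noteq> mask I g b"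
      using \<open>a \<noteq> b\<close> \<open>a \<notin> C\<close> \<open>b \<notin> C\<close>
      by (cases "mask I g a"; cases "mask I g b") (auto simp: violates_def supp_def)
    then show ?thesis
      by (cases "mask I g a"; cases "mask I g b") (auto simp: viol_entry_def)
  qed
  \<comment> \<open>A pair that is not a row of the matrix is violated by no generator with this
    mirror, so the sum vanishes there as well.\<close>
  have "(\<Sum>g\<in>gens I. viol_entry I ({a, b}, C) g * \<alpha> g) = 0"
  proof (cases "({a, b}, C) \<in> viol_rows I")
    case True
    then show ?thesis using fun_cong[OF \<alpha>, of "({a, b}, C)"] by (simp add: viol_map_def)
  next
    case False
    then have "viol_entry I ({a, b}, C) g = 0" if "g \<in> gens I" for g
      using that e by (auto simp: viol_rows_def viol_entry_def)
    then show ?thesis by simp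
  qed
  also have "(\<Sum>g\<in>gens I. viol_entry I ({a, b}, C) g * \<alpha> g) =
      (\<Sum>g\<in>{g \<in> {g \<in> gens I. \<alpha> g = 1}. mirror I g = C}. mask I g a + mask I g b)"
    by (rule sum.mono_neutral_cong_right) (auto simp: finite_gens entry)
  also have "\<dots> = clique_mask I \<alpha> C a + clique_mask I \<alpha> C b"
    by (simp only: clique_mask_def sum_apply sum.distrib)
  finally show ?thesis
    by (cases "clique_mask I \<alpha> C a"; cases "clique_mask I \<alpha> C b") simp_all
qed

end

section \<open>Partial reflections and the coset of solution codes\<close>

context
  fixes I :: "'k::{finite,linorder} ddgp"
  assumes ord: "ordered_instance I" and nondeg: "nondegenerate I"
begin

lemma constrained_vecs_subset: "gf2_vecs (constrained I) \<subseteq> gf2_vecs (branch_verts I)"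
  by (rule gf2_vecs_mono) (simp add: constrained_eq[OF ord])

text \<open>On the active vertices, flipping a clique mask reflects its support \<open>T\<close>
  across the hyperplane spanned by \<open>C\<close> in the embedding of \<open>s\<close> and leaves
  the rest in place. An active edge cut by \<open>T\<close> ends on that hyperplane.\<close>

lemma clique_mask_dist:
  assumes s: "s \<in> gf2_vecs (branch_verts I)" and \<alpha>: "viol_map I \<alpha> = 0"
    and C: "C \<in> preds I ` constrained I" and e: "{a, b} \<in> active_edges I"
  shows "norm (embed I (s + clique_mask I \<alpha> C) a - embed I (s + clique_mask I \<alpha> C) b) =
    norm (embed I s a - embed I s b)"
proof -
  let ?x = "embed I s" and ?m = "clique_mask I \<alpha> C" and ?y = "embed I (s + clique_mask I \<alpha> C)"
  define T where "T = supp ?m"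
  have T: "v \<in> T \<longleftrightarrow> ?m v = 1" for v by (simp add: T_def supp_def)
  note above = clique_mask_support(2)[OF ord, of \<alpha> C, folded T]
  have cut: "u \<in> T \<longleftrightarrow> v \<in> T" if "{u, v} \<in> active_edges I" "u \<notin> C" "v \<notin> C" for u v
    using clique_mask_constant[OF ord \<alpha> that] by (simp add: T)
  obtain q where q: "q \<in> constrained I" "preds I q = C" using C by blast
  then have qb: "q \<in> branch_verts I" by (simp add: constrained_eq[OF ord])
  obtain Q where Q: "\<And>v. norm (Q *v v) = norm v" "det Q = -1"
    and Qfix: "\<And>u v. u \<in> C \<Longrightarrow> v \<in> C \<Longrightarrow> Q *v (?x u - ?x v) = ?x u - ?x v"
    using lateration_mirror[OF ord qb nondegenerateD[OF ord nondeg s qb]] q(2) by metis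
  have "card C = CARD('k)" using ordered_instance_preds(2)[OF ord qb] q(2) by simp
  then obtain c where c: "c \<in> C" by fastforce
  \<comment> \<open>The affine reflection: the linear part \<open>Q\<close> recentred at a point of
    the mirror.\<close>
  define R where "R v = ?x c + Q *v (v - ?x c)" for v
  have R: "R v - R w = Q *v (v - w)" for v w
    using matrix_vector_mult_diff_distrib[of Q "v - ?x c" "w - ?x c"] by (simp add: R_def)
  have Rfix: "R (?x u) = ?x u" if "u \<in> C" for u
    using Qfix[OF that c] by (simp add: R_def)
  have A: "active_verts I \<inter> branch_verts I = constrained I"
    by (simp add: constrained_eq[OF ord])
  have flip: "?y v = (if v \<in> T then R (?x v) else ?x v)" if "v \<in> active_verts I" for v
  proof (rule embed_flip[OF ord nondeg s _ active_verts_subset[OF ord] _ _ _ Q R Rfix _ _ that,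
        unfolded A])
    show "s + ?m \<in> gf2_vecs (branch_verts I)"
      using s clique_mask_in_gf2_vecs[OF ord] constrained_vecs_subset gf2_vecs_add by blast
    show "preds I i \<subseteq> active_verts I" if "i \<in> constrained I" for i
      using that active_verts_preds by (auto simp: constrained_def)
    show "T \<subseteq> constrained I"
      using clique_mask_support(1)[OF ord] T by blast
    show "(s + ?m) i \<noteq> s i \<longleftrightarrow> i \<in> T" for i
      by (cases "s i"; cases "?m i") (simp_all add: T)
    have less: "u < i" if "i \<in> constrained I" "u \<in> preds I i" for i u
      using that ordered_instance_preds(5)[OF ord] by (auto simp: constrained_eq[OF ord])
    \<comment> \<open>Vertices of \<open>T\<close> lie above \<open>C\<close>, so for
      \<open>u\<close> outside \<open>C\<close> the active edge to \<open>i\<close> misses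
      \<open>C\<close> and cannot be cut by \<open>T\<close>.\<close>
    show "preds I i \<subseteq> T \<union> C" if "i \<in> T" for i
    proof
      fix u assume u: "u \<in> preds I i"
      have i: "i \<in> constrained I" using that \<open>T \<subseteq> constrained I\<close> by blast
      have "i \<notin> C" using above[OF that, of i] by auto
      then show "u \<in> T \<union> C" using cut[OF pred_edge_active[OF ord i u]] that by blast
    qed
    \<comment> \<open>A predecessor \<open>u\<close> in \<open>T\<close> would be above all of
      \<open>C\<close>, and \<open>i\<close> is above \<open>u\<close>. The edge would then miss
      \<open>C\<close> and yet be cut.\<close>
    show "preds I i \<inter> T = {}" if "i \<in> constrained I - T" for i
    proof -
      have "u \<notin> T" if u: "u \<in> preds I i" for u
      proof
        assume uT: "u \<in> T"
        have i: "i \<in> constrained I" using \<open>i \<in> constrained I - T\<close> by simp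
        have "u \<notin> C" using above[OF uT, of u] by auto
        moreover have "i \<notin> C" using above[OF uT, of i] less[OF i u] by auto
        ultimately show False
          using cut[OF pred_edge_active[OF ord i u]] uT \<open>i \<in> constrained I - T\<close> by blast
      qed
      then show ?thesis by blast
    qed
  qed
  have eqs: "?y a = (if a \<in> T then R (?x a) else ?x a)" "?y b = (if b \<in> T then R (?x b) else ?x b)"
    using flip active_edge_verts[OF ord e] by auto
  have Rnorm: "norm (R v - R w) = norm (v - w)" for v w by (simp add: R Q(1))
  show ?thesis
  proof (cases "a \<in> T \<longleftrightarrow> b \<in> T")
    case True
    then show ?thesis by (simp add: eqs Rnorm)
  next
    case False
    \<comment> \<open>Since \<open>T\<close> and \<open>C\<close> are disjoint, the endpoint in
      \<open>C\<close> is the unflipped one. \<open>R\<close> fixes it, so the new length is that of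
      an edge with both ends reflected.\<close>
    then have "a \<in> C \<or> b \<in> C" using cut[OF e] by blast
    then show ?thesis
      using False above Rfix[of a] Rfix[of b] Rnorm[of "?x a" "?x b"] by (auto simp: eqs)
  qed
qed

text \<open>The flip is carried out one clique at a time. Each stage applies
  \<open>clique_mask_dist\<close> to the code reached so far, with the mirror in its current
  position.\<close>

lemma mirror_space_dist:
  assumes s: "s \<in> gf2_vecs (branch_verts I)" and "h \<in> mirror_space I" and e: "{a, b} \<in> active_edges I"
  shows "norm (embed I (s + h) a - embed I (s + h) b) = norm (embed I s a - embed I s b)"
proof -
  obtain \<alpha> where \<alpha>: "viol_map I \<alpha> = 0" and h: "h = mask_map I \<alpha>"
    using assms(2) by (auto simp: mirror_space_def gf2_kernel_def)
  let ?s = "\<lambda>D. s + (\<Sum>C\<in>D. clique_mask I \<alpha> C)"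
  have "?s D \<in> gf2_vecs (branch_verts I) \<and>
      norm (embed I (?s D) a - embed I (?s D) b) = norm (embed I s a - embed I s b)"
    if "finite D" "D \<subseteq> preds I ` constrained I" for D
    using that
  proof (induction D rule: finite_induct)
    case empty
    then show ?case using s by (simp only: sum.empty add_0_right)
  next
    case (insert C D)
    have "?s (insert C D) = ?s D + clique_mask I \<alpha> C"
      using insert.hyps by (simp add: add_ac)
    then show ?case
      using insert clique_mask_dist[OF _ \<alpha> _ e] clique_mask_in_gf2_vecs[OF ord]
        constrained_vecs_subset gf2_vecs_add by (metis (no_types, lifting) insert_subset subsetD)
  qed
  then show ?thesis
    unfolding h mask_map_clique_masks[OF ord] using finite_constrained[OF ord] by blast
qed

lemma mirror_space_subset: "mirror_space I \<subseteq> gf2_vecs (constrained I)"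
proof -
  have "mask_map I \<alpha> v = 0" if "v \<notin> constrained I" for \<alpha> v
  proof -
    have "mask I g v = 0" if "g \<in> gens I" for g
      using mask_mirror_cases(2)[OF that, of v] \<open>v \<notin> constrained I\<close> by (metis bit_not_one_iff)
    then show ?thesis by (simp add: mask_map_def sum_apply)
  qed
  then show ?thesis by (auto simp: mirror_space_def gf2_vecs_def)
qed

text \<open>Active edges join active vertices, whose positions depend on constrained bits alone. So
  the choice of extension in \<open>constrained_solutions\<close> does not matter.\<close>

lemma realizes_active_cong:
  assumes "s \<in> gf2_vecs (branch_verts I)" "s' \<in> gf2_vecs (branch_verts I)"
    and "restr s' (constrained I) = restr s (constrained I)"
  shows "realizes I (active_edges I) (embed I s') \<longleftrightarrow> realizes I (active_edges I) (embed I s)"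
proof -
  have "s' i = s i" if "i \<in> constrained I" for i
    using fun_cong[OF assms(3), of i] that by (simp add: restr_def)
  then have "embed I s' v = embed I s v" if "v \<in> active_verts I" for v
    by (intro embed_cong[OF ord nondeg assms(1,2) active_verts_subset[OF ord] _ _ that])
      (auto simp: constrained_eq[OF ord] dest: active_verts_preds)
  then show ?thesis
    unfolding realizes_def using active_edge_verts[OF ord] by metis
qed

lemma constrained_solutions_iff:
  assumes "s \<in> gf2_vecs (branch_verts I)"
  shows "restr s (constrained I) \<in> constrained_solutions I \<longleftrightarrow>
    realizes I (active_edges I) (embed I s)"
proof -
  have "restr s (constrained I) \<in> constrained_solutions I \<longleftrightarrow>
      (\<forall>s'\<in>gf2_vecs (branch_verts I). restr s' (constrained I) = restr s (constrained I) \<longrightarrow>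
        realizes I (active_edges I) (embed I s'))"
    unfolding constrained_solutions_def using restr_in_gf2_vecs by blast
  then show ?thesis using realizes_active_cong[OF assms] assms by metis
qed

lemma realizes_disc_edges:
  assumes s: "s \<in> gf2_vecs (branch_verts I)"
  shows "realizes I (disc_edges I) (embed I s)"
  unfolding realizes_def
proof (intro allI impI)
  fix a b assume "{a, b} \<in> disc_edges I"
  then consider "a \<in> seed_verts I" "b \<in> seed_verts I" "a \<noteq> b"
    | "b \<in> branch_verts I" "a \<in> preds I b" | "a \<in> branch_verts I" "b \<in> preds I a"
    by (auto simp: disc_edges_def doubleton_eq_iff)
  then show "norm (embed I s a - embed I s b) = len I {a, b}"
  proof cases
    case 1
    then show ?thesis using ord by (simp add: embed_seed ordered_instance_def)
  next
    case 2
    then show ?thesis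
      using embed_lateration[OF ord nondeg s] by (auto simp: lateration_def dist_norm)
  next
    case 3
    then show ?thesis
      using embed_lateration[OF ord nondeg s]
      by (auto simp: lateration_def dist_norm norm_minus_commute insert_commute)
  qed
qed

text \<open>Discretization edges are realized by every code through seeds and spheres, so only
  active edges impose conditions.\<close>

lemma solutions_iff:
  assumes "s \<in> gf2_vecs (branch_verts I)"
  shows "s \<in> solutions I \<longleftrightarrow> restr s (constrained I) \<in> constrained_solutions I"
proof -
  have "edges I \<subseteq> disc_edges I \<union> active_edges I"
    by (auto simp: active_edges_def prune_edges_def)
  then have "realizes I (edges I) (embed I s) \<longleftrightarrow> realizes I (active_edges I) (embed I s)"
    using active_edges_subset[OF ord] realizes_disc_edges[OF assms]
    unfolding realizes_def by blast
  then show ?thesis using assms by (simp add: solutions_def constrained_solutions_iff)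
qed

text \<open>Flips in \<open>mirror_space\<close> keep all active lengths. Any other flip changes one
  of them by mirror separation, and the reference code already has the prescribed lengths.\<close>

lemma constrained_solutions_coset:
  assumes sep: "mirror_separated I" and s: "s \<in> solutions I"
  shows "constrained_solutions I = (\<lambda>h. restr s (constrained I) + h) ` mirror_space I"
proof -
  let ?c = "constrained I"
  have sb: "s \<in> gf2_vecs (branch_verts I)" using s by (simp add: solutions_def)
  have sr: "realizes I (active_edges I) (embed I s)"
    using s solutions_iff[OF sb] constrained_solutions_iff[OF sb] by simp
  have restr_h: "restr (s + h) ?c = restr s ?c + h" if "h \<in> gf2_vecs ?c" for h
    using that by (simp add: restr_add restr_id)
  have shb: "s + h \<in> gf2_vecs (branch_verts I)" if "h \<in> gf2_vecs ?c" for h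
    using that sb constrained_vecs_subset gf2_vecs_add by blast
  have "restr s ?c + h \<in> constrained_solutions I \<longleftrightarrow> h \<in> mirror_space I"
    if h: "h \<in> gf2_vecs ?c" for h
  proof -
    have "restr s ?c + h \<in> constrained_solutions I \<longleftrightarrow> realizes I (active_edges I) (embed I (s + h))"
      using constrained_solutions_iff[OF shb[OF h]] restr_h[OF h] by simp
    also have "\<dots> \<longleftrightarrow> h \<in> mirror_space I"
    proof
      assume r: "realizes I (active_edges I) (embed I (s + h))"
      show "h \<in> mirror_space I"
      proof (rule ccontr)
        assume "h \<notin> mirror_space I"
        then obtain a b where "{a, b} \<in> active_edges I"
          "(norm (embed I (s + h) a - embed I (s + h) b))\<^sup>2 \<noteq> (norm (embed I s a - embed I s b))\<^sup>2"
          using sep h sb unfolding mirror_separated_def by blast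
        with r sr show False by (simp add: realizes_def)
      qed
    next
      assume "h \<in> mirror_space I"
      then show "realizes I (active_edges I) (embed I (s + h))"
        using sr mirror_space_dist[OF sb] by (simp add: realizes_def)
    qed
    finally show ?thesis .
  qed
  \<comment> \<open>Adding the reference code twice cancels, so each constrained code
    \<open>t\<close> is reached by the flip \<open>restr s ?c + t\<close>.\<close>
  moreover have "t \<in> (\<lambda>h. restr s ?c + h) ` gf2_vecs ?c" if "t \<in> gf2_vecs ?c" for t
    using gf2_vecs_add[OF restr_in_gf2_vecs that] gf2_add_cancel by (metis image_eqI)
  moreover have "constrained_solutions I \<subseteq> gf2_vecs ?c"
    by (auto simp: constrained_solutions_def)
  ultimately show ?thesis using mirror_space_subset by blast
qed

text \<open>A solution is a constrained solution together with an arbitrary choice of the free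
  bits.\<close>

lemma card_solutions:
  "card (solutions I) = 2 ^ card (free_verts I) * card (constrained_solutions I)"
proof -
  let ?b = "branch_verts I" and ?c = "constrained I" and ?f = "free_verts I"
  have split: "?c \<union> ?f = ?b" "?c \<inter> ?f = {}"
    by (auto simp: free_verts_def constrained_eq[OF ord])
  have "finite ?f" by (simp add: free_verts_def branch_verts_def verts_def)
  have cs: "constrained_solutions I \<subseteq> gf2_vecs ?c"
    by (auto simp: constrained_solutions_def)
  have glue: "restr (t + u) ?c = t" "restr (t + u) ?f = u" "t + u \<in> gf2_vecs ?b"
    if "t \<in> gf2_vecs ?c" "u \<in> gf2_vecs ?f" for t u
    using that split by (auto simp: restr_def gf2_vecs_def fun_eq_iff)
  have "bij_betw (\<lambda>s. (restr s ?c, restr s ?f)) (solutions I)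
      (constrained_solutions I \<times> gf2_vecs ?f)"
  proof (rule bij_betw_byWitness[where f' = "\<lambda>(t, u). t + u"])
    show "\<forall>s\<in>solutions I. (\<lambda>(t, u). t + u) (restr s ?c, restr s ?f) = s"
      using split by (auto simp: restr_def solutions_def gf2_vecs_def fun_eq_iff)
    show "(\<lambda>s. (restr s ?c, restr s ?f)) ` solutions I \<subseteq> constrained_solutions I \<times> gf2_vecs ?f"
      using solutions_iff restr_in_gf2_vecs by (auto simp: solutions_def)
    show "(\<lambda>(t, u). t + u) ` (constrained_solutions I \<times> gf2_vecs ?f) \<subseteq> solutions I"
      using solutions_iff glue cs by auto
    show "\<forall>p\<in>constrained_solutions I \<times> gf2_vecs ?f. (restr ((\<lambda>(t, u). t + u) p) ?c,
        restr ((\<lambda>(t, u). t + u) p) ?f) = p"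
      using glue cs by auto
  qed
  then show ?thesis
    using card_gf2_vecs[OF \<open>finite ?f\<close>] by (simp add: bij_betw_same_card card_cartesian_product)
qed

end

theorem theorem1:
  fixes I :: "('k :: {finite, linorder}) ddgp"
  assumes "2 \<le> CARD('k)"
    and "ordered_instance I"
    and "nondegenerate I"
    and "solutions I \<noteq> {}"
    and "mirror_separated I"
  shows "(\<forall>s\<in>solutions I.
            constrained_solutions I = (\<lambda>h. restr s (constrained I) + h) ` mirror_space I \<and>
            constrained_solutions I = (\<lambda>h. restr s (constrained I) + h) `
              (mask_map I ` gf2_kernel (gen_space I) (viol_map I)))
       \<and> card (solutions I) =
           2 ^ (card (free_verts I) + gf2_rank (gen_space I) (stacked_map I)
                - gf2_rank (gen_space I) (viol_map I))"
proof -
  note coset = constrained_solutions_coset[OF assms(2,3,5)]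
  obtain s where s: "s \<in> solutions I" using assms(4) by blast
  have "inj_on (\<lambda>h. restr s (constrained I) + h) (mirror_space I)"
    by (rule inj_on_inverseI[where g = "\<lambda>h. restr s (constrained I) + h"]) (rule gf2_add_cancel)
  then have "card (constrained_solutions I) = card (mirror_space I)"
    unfolding coset[OF s] by (rule card_image)
  \<comment> \<open>The rank inequality in \<open>mirror_space_card\<close> allows the number of
    free bits to be moved inside the truncated subtraction.\<close>
  then have "card (solutions I) = 2 ^ (card (free_verts I) + gf2_rank (gen_space I) (stacked_map I)
      - gf2_rank (gen_space I) (viol_map I))"
    using mirror_space_card[OF finite_gens[OF assms(2)]] card_solutions[OF assms(2,3)]
    by (simp flip: power_add)
  with coset show ?thesis unfolding mirror_space_def by blast
qed

end
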